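(* Let $\Gamma$ be a set and $\lambda:\Gamma\to\Gamma$ a self-map. Then $s(\lambda)=s(\lambda^{\mathrm{sc}})$ and $ns(\lambda)=ns(\lambda^{\mathrm{sc}})$; moreover, if $\Gamma$ is an abelian group and $\lambda\in\mathrm{End}(\Gamma)$, then $s_0(\lambda)=s_0(\lambda^{\mathrm{sc}})$.
   Context: $\mathbb N=\{0,1,2,\dots\}$ and $\mathbb N_+=\mathbb N\setminus\{0\}$. Let $\lambda:\Gamma\to\Gamma$ be a self-map of a set. $Q\mathrm{Per}(\lambda)$ is the set of $x\in\Gamma$ such that $\lambda^n(x)=\lambda^m(x)$ for some $n<m$ in $\mathbb N$. A string of $\lambda$ is a sequence $S=\{x_n\}_{n\in\mathbb N}$ of pairwise distinct elements of $\Gamma$ with $\lambda(x_n)=x_{n-1}$ for every $n\in\mathbb N_+$. A string is singular if $x_0\in Q\mathrm{Per}(\lambda)$, and non-singular otherwise; when $\Gamma$ is an abelian group and $\lambda$ an endomorphism, it is a null string if $x_0\neq 0$ and $\lambda^k(x_0)=0$ for some $k\in\mathbb N_+$. The numbers $s(\lambda)$, $ns(\lambda)$, $s_0(\lambda)$ are the suprema of $|\mathcal F|$ over all families $\mathcal F$ of pairwise disjoint strings, respectively non-singular strings, respectively (in the group case) null strings, of $\lambda$ in $\Gamma$ (disjointness refers to the underlying sets of elements). They take values in $\mathbb N\cup\{\infty\}$: each is set equal to $\infty$ whenever the supremum is infinite. The surjective core $\mathrm{sc}(\lambda)$ is the largest subset $\Lambda\subseteq\Gamma$ with $\lambda(\Lambda)=\Lambda$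 (it always exists, may be empty for a set-map, and is a subgroup when $\lambda$ is a group endomorphism); $\lambda^{\mathrm{sc}}:\mathrm{sc}(\lambda)\to\mathrm{sc}(\lambda)$ denotes the restriction of $\lambda$. *)

theory Defs
  imports "HOL-Algebra.Group" "HOL-Library.Extended_Nat" "HOL-Library.FuncSet"
begin

text \<open>A self-map of a set \<open>\<Gamma>\<close> is a function \<open>f\<close> with \<open>f \<in> \<Gamma> \<rightarrow> \<Gamma>\<close>; its values outside \<open>\<Gamma>\<close> are irrelevant
  to all the notions below.\<close>

definition QPer :: "'a set \<Rightarrow> ('a \<Rightarrow> 'a) \<Rightarrow> 'a set" where
  "QPer \<Gamma> f = {x \<in> \<Gamma>. \<exists>n m. n < m \<and> (f ^^ n) x = (f ^^ m) x}"

definition is_string :: "'a set \<Rightarrow> ('a \<Rightarrow> 'a) \<Rightarrow> (nat \<Rightarrow> 'a) \<Rightarrow> bool" where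
  "is_string \<Gamma> f S \<longleftrightarrow> range S \<subseteq> \<Gamma> \<and> inj S \<and> (\<forall>n>0. f (S n) = S (n - 1))"

definition singular_string :: "'a set \<Rightarrow> ('a \<Rightarrow> 'a) \<Rightarrow> (nat \<Rightarrow> 'a) \<Rightarrow> bool" where
  "singular_string \<Gamma> f S \<longleftrightarrow> is_string \<Gamma> f S \<and> S 0 \<in> QPer \<Gamma> f"

definition nonsingular_string :: "'a set \<Rightarrow> ('a \<Rightarrow> 'a) \<Rightarrow> (nat \<Rightarrow> 'a) \<Rightarrow> bool" where
  "nonsingular_string \<Gamma> f S \<longleftrightarrow> is_string \<Gamma> f S \<and> \<not> singular_string \<Gamma> f S"

text \<open>Groups are written multiplicatively, so \<open>\<one>\<close> plays the role of \<open>0\<close>.\<close>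

definition null_string :: "('a, 'b) monoid_scheme \<Rightarrow> ('a \<Rightarrow> 'a) \<Rightarrow> (nat \<Rightarrow> 'a) \<Rightarrow> bool" where
  "null_string G f S \<longleftrightarrow>
     is_string (carrier G) f S \<and> S 0 \<noteq> \<one>\<^bsub>G\<^esub> \<and> (\<exists>k>0. (f ^^ k) (S 0) = \<one>\<^bsub>G\<^esub>)"

definition ecard :: "'a set \<Rightarrow> enat" where
  "ecard A = (if finite A then enat (card A) else \<infinity>)"

text \<open>Strings are nonempty, so pairwise disjoint strings are distinct as sequences and it is
  enough to consider sets (rather than indexed families) of sequences.\<close>

definition max_disjoint :: "((nat \<Rightarrow> 'a) \<Rightarrow> bool) \<Rightarrow> enat" where
  "max_disjoint P =
     (SUP F \<in> {F. (\<forall>S\<in>F. P S) \<and> pairwise (\<lambda>S T. range S \<inter> range T = {}) F}. ecard F)"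

definition string_number :: "'a set \<Rightarrow> ('a \<Rightarrow> 'a) \<Rightarrow> enat" where
  "string_number \<Gamma> f = max_disjoint (is_string \<Gamma> f)"

definition ns_string_number :: "'a set \<Rightarrow> ('a \<Rightarrow> 'a) \<Rightarrow> enat" where
  "ns_string_number \<Gamma> f = max_disjoint (nonsingular_string \<Gamma> f)"

definition null_string_number :: "('a, 'b) monoid_scheme \<Rightarrow> ('a \<Rightarrow> 'a) \<Rightarrow> enat" where
  "null_string_number G f = max_disjoint (null_string G f)"

definition surj_core :: "'a set \<Rightarrow> ('a \<Rightarrow> 'a) \<Rightarrow> 'a set" where
  "surj_core \<Gamma> f = (GREATEST \<Lambda>. \<Lambda> \<subseteq> \<Gamma> \<and> f ` \<Lambda> = \<Lambda>)"

lemma surj_core_eq_Union: "surj_core \<Gamma> f = \<Union>{\<Lambda>. \<Lambda> \<subseteq> \<Gamma> \<and> f ` \<Lambda> = \<Lambda>}"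
  unfolding surj_core_def by (rule Greatest_equality) blast+

lemma surj_core_subset: "surj_core \<Gamma> f \<subseteq> \<Gamma>"
  unfolding surj_core_eq_Union by blast

lemma surj_core_image: "f ` surj_core \<Gamma> f = surj_core \<Gamma> f"
  unfolding surj_core_eq_Union by blast

lemma surj_core_greatest: "\<Lambda> \<subseteq> \<Gamma> \<Longrightarrow> f ` \<Lambda> = \<Lambda> \<Longrightarrow> \<Lambda> \<subseteq> surj_core \<Gamma> f"
  unfolding surj_core_eq_Union by blast

definition core_map :: "'a set \<Rightarrow> ('a \<Rightarrow> 'a) \<Rightarrow> 'a \<Rightarrow> 'a" where
  "core_map \<Gamma> f = restrict f (surj_core \<Gamma> f)"

definition core_group :: "('a, 'b) monoid_scheme \<Rightarrow> ('a \<Rightarrow> 'a) \<Rightarrow> ('a, 'b) monoid_scheme" where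
  "core_group G f = G\<lparr>carrier := surj_core (carrier G) f\<rparr>"

lemma subgroup_surj_core:
  fixes G (structure)
  assumes "comm_group G" "f \<in> hom G G"
  shows "subgroup (surj_core (carrier G) f) G"
proof -
  interpret comm_group G by fact
  interpret group_hom G G f
    using assms by (simp add: group_hom_def group_hom_axioms_def is_group)
  let ?C = "surj_core (carrier G) f"
  have sub: "x \<in> carrier G" if "x \<in> ?C" for x
    using that by (rule subsetD[OF surj_core_subset])
  have into: "f x \<in> ?C" if "x \<in> ?C" for x
    using that surj_core_image[of f "carrier G"] by (metis imageI)
  have pre: "\<exists>y\<in>?C. f y = x" if "x \<in> ?C" for x
    using that surj_core_image[of f "carrier G"] by (metis imageE)
  show ?thesis
  proof (rule subgroupI)
    show "?C \<subseteq> carrier G" by (rule surj_core_subset)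
    have "{\<one>} \<subseteq> ?C" by (rule surj_core_greatest) auto
    then show "?C \<noteq> {}" by blast
  next
    fix a assume a: "a \<in> ?C"
    have "(\<lambda>x. inv x) ` ?C \<subseteq> ?C"
    proof (rule surj_core_greatest)
      show "(\<lambda>x. inv x) ` ?C \<subseteq> carrier G" using sub by auto
      have "f ` (\<lambda>x. inv x) ` ?C = (\<lambda>x. inv x) ` f ` ?C"
        unfolding image_image by (rule image_cong) (auto simp: sub)
      then show "f ` (\<lambda>x. inv x) ` ?C = (\<lambda>x. inv x) ` ?C"
        by (simp only: surj_core_image)
    qed
    then show "inv a \<in> ?C" using a by blast
  next
    fix a b assume ab: "a \<in> ?C" "b \<in> ?C"
    let ?P = "{x \<otimes> y | x y. x \<in> ?C \<and> y \<in> ?C}"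
    have "?P \<subseteq> ?C"
    proof (rule surj_core_greatest)
      show "?P \<subseteq> carrier G" using sub by auto
      show "f ` ?P = ?P"
      proof (intro equalityI subsetI)
        fix z assume "z \<in> f ` ?P"
        then obtain x y where "x \<in> ?C" "y \<in> ?C" "z = f (x \<otimes> y)" by blast
        moreover from this have "z = f x \<otimes> f y" by (simp add: sub)
        ultimately show "z \<in> ?P" using into by blast
      next
        fix z assume "z \<in> ?P"
        then obtain x y where "x \<in> ?C" "y \<in> ?C" "z = x \<otimes> y" by blast
        moreover from this obtain u v where "u \<in> ?C" "v \<in> ?C" "f u = x" "f v = y"
          using pre by meson
        ultimately have "u \<otimes> v \<in> ?P" "z = f (u \<otimes> v)" by (auto simp: sub)
        then show "z \<in> f ` ?P" by blast
      qed
    qed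
    then show "a \<otimes> b \<in> ?C" using ab by blast
  qed
qed

end

theory Submission
  imports Defs
begin

text \<open>
  Passing to the surjective core loses no string and changes no property of a string.
  If \<open>S\<close> is a string of \<open>f\<close>, then the terms of \<open>S\<close> together with the forward orbit of \<open>S 0\<close>
  form a set that \<open>f\<close> maps onto itself: every term \<open>S n\<close> has the preimage \<open>S (n + 1)\<close>, and the
  orbit is pushed along itself, starting at the term \<open>S 0\<close>. By maximality this set is contained in
  the surjective core, so \<open>S\<close> lies in the core (\<open>string_in_surj_core\<close>). Conversely, the core is
  \<open>f\<close>-invariant, so \<open>f\<close> and its restriction have the same iterates there
  (\<open>funpow_core_map\<close>), and being singular or null depends only on the iterates at \<open>S 0\<close>.
  Hence the three kinds of strings of \<open>f\<close> are literally those of the restriction, and the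
  suprema are taken over the same families.
\<close>

text \<open>
  The terms of a string need not form an \<open>f\<close>-invariant set, since \<open>f (S 0)\<close> may lie outside it;
  adding the forward orbit of \<open>S 0\<close> repairs this without losing surjectivity.
\<close>

lemma string_in_surj_core:
  assumes f: "f \<in> \<Gamma> \<rightarrow> \<Gamma>" and S: "is_string \<Gamma> f S"
  shows "range S \<subseteq> surj_core \<Gamma> f"
proof -
  let ?O = "range (\<lambda>k. (f ^^ k) (S 0))"
  have in\<Gamma>: "S n \<in> \<Gamma>" for n
    using S by (auto simp: is_string_def)
  have step: "f (S (Suc n)) = S n" for n
    using S by (simp add: is_string_def)
  have orbit: "(f ^^ k) (S 0) \<in> \<Gamma>" for k
    using f in\<Gamma> by (induction k) auto
  have "range S \<union> ?O \<subseteq> surj_core \<Gamma> f"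
  proof (rule surj_core_greatest)
    show "range S \<union> ?O \<subseteq> \<Gamma>"
      using in\<Gamma> orbit by blast
    show "f ` (range S \<union> ?O) = range S \<union> ?O"
    proof (intro equalityI subsetI)
      fix y assume "y \<in> f ` (range S \<union> ?O)"
      then consider n where "y = f (S n)" | k where "y = f ((f ^^ k) (S 0))"
        by blast
      then show "y \<in> range S \<union> ?O"
      proof cases
        case (1 n)
        show ?thesis
        proof (cases n)
          case 0
          then have "y = (f ^^ 1) (S 0)" using 1 by simp
          then show ?thesis by blast
        next
          case (Suc m)
          then show ?thesis using 1 step by simp
        qed
      next
        case (2 k)
        then have "y = (f ^^ Suc k) (S 0)" by simp
        then show ?thesis by blast
      qed
    next
      fix y assume "y \<in> range S \<union> ?O"
      then consider n where "y = S n" | k where "y = (f ^^ k) (S 0)"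
        by blast
      then show "y \<in> f ` (range S \<union> ?O)"
      proof cases
        case (1 n)
        then have "y = f (S (Suc n))" by (simp add: step)
        then show ?thesis by blast
      next
        case (2 k)
        show ?thesis
        proof (cases k)
          case 0
          then have "y = f (S 1)" using 2 step[of 0] by simp
          then show ?thesis by blast
        next
          case (Suc j)
          then have "y = f ((f ^^ j) (S 0))" using 2 by simp
          then show ?thesis by blast
        qed
      qed
    qed
  qed
  then show ?thesis by blast
qed

lemma funpow_core_map:
  assumes "x \<in> surj_core \<Gamma> f"
  shows "(core_map \<Gamma> f ^^ k) x = (f ^^ k) x"
proof -
  have "(f ^^ k) x \<in> surj_core \<Gamma> f" for k
    using assms surj_core_image[of f \<Gamma>] by (induction k) auto
  then show ?thesis
    by (induction k) (simp_all add: core_map_def)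
qed

lemma is_string_core:
  assumes "f \<in> \<Gamma> \<rightarrow> \<Gamma>"
  shows "is_string (surj_core \<Gamma> f) (core_map \<Gamma> f) S \<longleftrightarrow> is_string \<Gamma> f S"
proof -
  have "is_string (surj_core \<Gamma> f) (core_map \<Gamma> f) S
      \<longleftrightarrow> range S \<subseteq> surj_core \<Gamma> f \<and> is_string \<Gamma> f S"
    using surj_core_subset[of \<Gamma> f]
    by (auto simp: is_string_def core_map_def image_subset_iff)
  then show ?thesis
    using string_in_surj_core[OF assms] by blast
qed

lemma QPer_core:
  "x \<in> surj_core \<Gamma> f \<Longrightarrow> x \<in> QPer (surj_core \<Gamma> f) (core_map \<Gamma> f) \<longleftrightarrow> x \<in> QPer \<Gamma> f"
  using surj_core_subset[of \<Gamma> f] by (auto simp: QPer_def funpow_core_map)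

text \<open>
  Strings on both sides start in the core, so the membership of \<open>S 0\<close> in the two sets of
  quasi-periodic points only has to be compared there.
\<close>

lemma nonsingular_string_core:
  assumes "f \<in> \<Gamma> \<rightarrow> \<Gamma>"
  shows "nonsingular_string (surj_core \<Gamma> f) (core_map \<Gamma> f) S \<longleftrightarrow> nonsingular_string \<Gamma> f S"
  using string_in_surj_core[OF assms, of S] QPer_core[of "S 0" \<Gamma> f]
  by (auto simp: nonsingular_string_def singular_string_def is_string_core[OF assms])

lemma null_string_core:
  assumes "f \<in> carrier G \<rightarrow> carrier G"
  shows "null_string (core_group G f) (core_map (carrier G) f) S \<longleftrightarrow> null_string G f S"
proof (cases "is_string (carrier G) f S")
  case True
  then have "S 0 \<in> surj_core (carrier G) f"
    using string_in_surj_core[OF assms] by blast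
  then show ?thesis
    by (simp add: null_string_def core_group_def is_string_core[OF assms] funpow_core_map)
next
  case False
  then show ?thesis
    by (simp add: null_string_def core_group_def is_string_core[OF assms])
qed

theorem proposition2p3:
  fixes \<Gamma> :: "'a set" and f :: "'a \<Rightarrow> 'a"
  assumes "f \<in> \<Gamma> \<rightarrow> \<Gamma>"
  shows "string_number \<Gamma> f = string_number (surj_core \<Gamma> f) (core_map \<Gamma> f) \<and>
         ns_string_number \<Gamma> f = ns_string_number (surj_core \<Gamma> f) (core_map \<Gamma> f) \<and>
         (\<forall>G :: ('a, 'b) monoid_scheme. comm_group G \<and> carrier G = \<Gamma> \<and> f \<in> hom G G \<longrightarrow>
            null_string_number G f = null_string_number (core_group G f) (core_map \<Gamma> f))"
proof (intro conjI allI impI)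
  show "string_number \<Gamma> f = string_number (surj_core \<Gamma> f) (core_map \<Gamma> f)"
    by (simp add: string_number_def max_disjoint_def is_string_core[OF assms])
  show "ns_string_number \<Gamma> f = ns_string_number (surj_core \<Gamma> f) (core_map \<Gamma> f)"
    by (simp add: ns_string_number_def max_disjoint_def nonsingular_string_core[OF assms])
next
  fix G :: "('a, 'b) monoid_scheme"
  assume "comm_group G \<and> carrier G = \<Gamma> \<and> f \<in> hom G G"
  then show "null_string_number G f = null_string_number (core_group G f) (core_map \<Gamma> f)"
    using assms by (auto simp: null_string_number_def max_disjoint_def null_string_core)
qed

end
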